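(* Let $G=\mathbb{Z}/3\ast\mathbb{Z}/3=\langle a,b\mid a^3=b^3=1\rangle$ and let $\varphi\in\mathrm{Aut}(G)$ be the order-$2$ automorphism interchanging $a$ and $b$. Let $\xi_k$ be the growth function of the corresponding $2$-valued coset group $\mathbb{G}_\varphi(G)$ with respect to the element $g=[a,b]$. Then for all integers $k\ge 0$ $$\xi_k = F_{k+3}-1=\frac{1}{\sqrt5}\left(\left(\frac{1+\sqrt5}{2}\right)^{k+3}-\left(\frac{1-\sqrt5}{2}\right)^{k+3}\right)-1,$$ where $F_0=0$, $F_1=1$, $F_n=F_{n-1}+F_{n-2}$ is the Fibonacci sequence. In particular, the growth is exponential: $\xi_k\sim \dfrac{\phi^{k+3}}{\sqrt5}$ as $k\to\infty$, where $\phi=\dfrac{1+\sqrt5}{2}$.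
   Context: Coset group: let $G$ be a group and $\varphi\in\mathrm{Aut}(G)$ an automorphism of finite order $n$. Let $X=G/\langle\varphi\rangle$ be the set of orbits of the cyclic group $\langle\varphi\rangle$ acting on $G$, with quotient map $\pi:G\to X$. The $n$-valued coset group $\mathbb{G}_\varphi(G)$ is the set $X$ with the $n$-valued multiplication $x*y=[\pi(u\,\varphi^i(v)) : 0\le i<n]$ (a multiset of $n$ elements of $X$), where $u\in\pi^{-1}(x)$, $v\in\pi^{-1}(y)$; this is independent of the choice of $u,v$. Its unit is $e=\pi(1)$. Growth function: suppose $\varphi$ cyclically permutes the given generators $f_1,\dots,f_n$ of $G$, and let $g=[f_1,\dots,f_n]\in X$ be their common orbit. Let $g^1$ be the multiset consisting of $g$, and let $g^{k}$ be the multiset union of the multisets $g*x$ for $x$ running over $g^{k-1}$. Then $\xi_k$ ($k\ge0$) is the number of distinct elements of $X$ in $\{e\}\cup g\cup g^2\cup\dots\cup g^k$. The notation $\sim$ means that the ratio tends to $1$. *)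

theory Defs
  imports
    "HOL-Algebra.Algebra"
    "HOL-Library.Multiset"
    "HOL-Library.Landau_Symbols"
    "HOL-Number_Theory.Cong"
    "HOL-Number_Theory.Fib"
begin

section \<open>Free product of two groups\<close>

text \<open>
  The free product is the set of words with letters in the disjoint union of the two carriers,
  modulo the congruence generated by deleting identity letters and by multiplying adjacent
  letters from the same factor.
\<close>

definition fp_words :: "('a, 'c) monoid_scheme \<Rightarrow> ('b, 'd) monoid_scheme \<Rightarrow> ('a + 'b) list set"
  where "fp_words G H = lists (Inl ` carrier G \<union> Inr ` carrier H)"

inductive fp_eq :: "('a, 'c) monoid_scheme \<Rightarrow> ('b, 'd) monoid_scheme
    \<Rightarrow> ('a + 'b) list \<Rightarrow> ('a + 'b) list \<Rightarrow> bool"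
  for G (structure) and H (structure) where
  fp_refl: "w \<in> fp_words G H \<Longrightarrow> fp_eq G H w w"
| fp_sym: "fp_eq G H v w \<Longrightarrow> fp_eq G H w v"
| fp_trans: "fp_eq G H u v \<Longrightarrow> fp_eq G H v w \<Longrightarrow> fp_eq G H u w"
| fp_oneL: "u \<in> fp_words G H \<Longrightarrow> v \<in> fp_words G H \<Longrightarrow>
    fp_eq G H (u @ [Inl \<one>\<^bsub>G\<^esub>] @ v) (u @ v)"
| fp_oneR: "u \<in> fp_words G H \<Longrightarrow> v \<in> fp_words G H \<Longrightarrow>
    fp_eq G H (u @ [Inr \<one>\<^bsub>H\<^esub>] @ v) (u @ v)"
| fp_multL: "u \<in> fp_words G H \<Longrightarrow> v \<in> fp_words G H \<Longrightarrow> x \<in> carrier G \<Longrightarrow> y \<in> carrier G \<Longrightarrow>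
    fp_eq G H (u @ [Inl x, Inl y] @ v) (u @ [Inl (x \<otimes>\<^bsub>G\<^esub> y)] @ v)"
| fp_multR: "u \<in> fp_words G H \<Longrightarrow> v \<in> fp_words G H \<Longrightarrow> x \<in> carrier H \<Longrightarrow> y \<in> carrier H \<Longrightarrow>
    fp_eq G H (u @ [Inr x, Inr y] @ v) (u @ [Inr (x \<otimes>\<^bsub>H\<^esub> y)] @ v)"

definition fp_rel :: "('a, 'c) monoid_scheme \<Rightarrow> ('b, 'd) monoid_scheme
    \<Rightarrow> (('a + 'b) list \<times> ('a + 'b) list) set"
  where "fp_rel G H = {(v, w). fp_eq G H v w}"

definition free_product :: "('a, 'c) monoid_scheme \<Rightarrow> ('b, 'd) monoid_scheme
    \<Rightarrow> ('a + 'b) list set monoid"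
  where "free_product G H =
    \<lparr>carrier = fp_words G H // fp_rel G H,
     monoid.mult = (\<lambda>A B. \<Union>u\<in>A. \<Union>v\<in>B. fp_rel G H `` {u @ v}),
     one = fp_rel G H `` {[]}\<rparr>"

definition fp_inl :: "('a, 'c) monoid_scheme \<Rightarrow> ('b, 'd) monoid_scheme \<Rightarrow> 'a \<Rightarrow> ('a + 'b) list set"
  where "fp_inl G H x = fp_rel G H `` {[Inl x]}"

definition fp_inr :: "('a, 'c) monoid_scheme \<Rightarrow> ('b, 'd) monoid_scheme \<Rightarrow> 'b \<Rightarrow> ('a + 'b) list set"
  where "fp_inr G H y = fp_rel G H `` {[Inr y]}"

context
  fixes G :: "('a, 'c) monoid_scheme" and H :: "('b, 'd) monoid_scheme"
  assumes G: "group G" and H: "group H"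
begin

lemma fp_words_append [simp]: "u @ v \<in> fp_words G H \<longleftrightarrow> u \<in> fp_words G H \<and> v \<in> fp_words G H"
  by (auto simp: fp_words_def)

lemma fp_words_Nil [simp]: "[] \<in> fp_words G H"
  by (simp add: fp_words_def)

lemma fp_words_Cons_Inl [simp]: "Inl x # w \<in> fp_words G H \<longleftrightarrow> x \<in> carrier G \<and> w \<in> fp_words G H"
  by (auto simp: fp_words_def)

lemma fp_words_Cons_Inr [simp]: "Inr y # w \<in> fp_words G H \<longleftrightarrow> y \<in> carrier H \<and> w \<in> fp_words G H"
  by (auto simp: fp_words_def)

lemma fp_eq_words: "fp_eq G H v w \<Longrightarrow> v \<in> fp_words G H \<and> w \<in> fp_words G H"
proof -
  interpret G: group G by (rule G)
  interpret H: group H by (rule H)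
  show "fp_eq G H v w \<Longrightarrow> v \<in> fp_words G H \<and> w \<in> fp_words G H"
    by (induction rule: fp_eq.induct) auto
qed

lemma fp_eq_context:
  assumes "fp_eq G H v w" "p \<in> fp_words G H" "q \<in> fp_words G H"
  shows "fp_eq G H (p @ v @ q) (p @ w @ q)"
  using assms
proof (induction rule: fp_eq.induct)
  case (fp_refl w) then show ?case by (intro fp_eq.fp_refl) simp
next
  case (fp_sym v w) then show ?case by (blast intro: fp_eq.fp_sym)
next
  case (fp_trans u v w) then show ?case by (blast intro: fp_eq.fp_trans)
next
  case (fp_oneL u v) then show ?case using fp_eq.fp_oneL[of "p @ u" G H "v @ q"] by simp
next
  case (fp_oneR u v) then show ?case using fp_eq.fp_oneR[of "p @ u" G H "v @ q"] by simp
next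
  case (fp_multL u v x y) then show ?case using fp_eq.fp_multL[of "p @ u" G H "v @ q" x y] by simp
next
  case (fp_multR u v x y) then show ?case using fp_eq.fp_multR[of "p @ u" G H "v @ q" x y] by simp
qed

lemma fp_eq_append:
  assumes "fp_eq G H u u'" "fp_eq G H v v'"
  shows "fp_eq G H (u @ v) (u' @ v')"
proof -
  have "fp_eq G H (u @ v) (u' @ v)"
    using fp_eq_context[OF assms(1), of "[]" v] fp_eq_words[OF assms(2)] by simp
  moreover have "fp_eq G H (u' @ v) (u' @ v')"
    using fp_eq_context[OF assms(2), of u' "[]"] fp_eq_words[OF assms(1)] by simp
  ultimately show ?thesis by (rule fp_eq.fp_trans)
qed

lemma equiv_fp_rel: "equiv (fp_words G H) (fp_rel G H)"
proof (rule equivI)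
  show "fp_rel G H \<subseteq> fp_words G H \<times> fp_words G H"
    using fp_eq_words by (auto simp: fp_rel_def)
  show "refl_on (fp_words G H) (fp_rel G H)"
    by (auto simp: refl_on_def fp_rel_def intro: fp_refl)
  show "sym (fp_rel G H)" by (auto simp: sym_def fp_rel_def intro: fp_sym)
  show "trans (fp_rel G H)" by (auto simp: trans_def fp_rel_def intro: fp_trans)
qed

lemma fp_class_eq_iff:
  assumes "u \<in> fp_words G H" "v \<in> fp_words G H"
  shows "fp_rel G H `` {u} = fp_rel G H `` {v} \<longleftrightarrow> fp_eq G H u v"
  using eq_equiv_class_iff[OF equiv_fp_rel assms] by (simp add: fp_rel_def)

lemma fp_mult_class:
  assumes "u \<in> fp_words G H" "v \<in> fp_words G H"
  shows "(fp_rel G H `` {u}) \<otimes>\<^bsub>free_product G H\<^esub> (fp_rel G H `` {v}) = fp_rel G H `` {u @ v}"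
proof -
  have "congruent2 (fp_rel G H) (fp_rel G H) (\<lambda>u v. fp_rel G H `` {u @ v})"
  proof (rule congruent2I[OF equiv_fp_rel equiv_fp_rel])
    fix y z w assume yz: "(y, z) \<in> fp_rel G H" and w: "w \<in> fp_words G H"
    then have e: "fp_eq G H y z" by (simp add: fp_rel_def)
    note yz = fp_eq_words[OF e]
    show "fp_rel G H `` {y @ w} = fp_rel G H `` {z @ w}"
      using fp_eq_append[OF e fp_refl[OF w]] yz w by (subst fp_class_eq_iff) auto
    show "fp_rel G H `` {w @ y} = fp_rel G H `` {w @ z}"
      using fp_eq_append[OF fp_refl[OF w] e] yz w by (subst fp_class_eq_iff) auto
  qed
  from UN_equiv_class2[OF equiv_fp_rel equiv_fp_rel this assms] show ?thesis
    by (simp add: free_product_def)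
qed

lemma fp_carrier: "carrier (free_product G H) = (\<lambda>w. fp_rel G H `` {w}) ` fp_words G H"
  by (auto simp: free_product_def quotient_def)

lemma fp_one: "\<one>\<^bsub>free_product G H\<^esub> = fp_rel G H `` {[]}"
  by (simp add: free_product_def)

lemma fp_word_inverse: "w \<in> fp_words G H \<Longrightarrow> \<exists>v \<in> fp_words G H. fp_eq G H (v @ w) []"
proof (induction w)
  case Nil show ?case by (intro bexI[of _ "[]"]) (auto intro: fp_refl)
next
  interpret G: group G by (rule G)
  interpret H: group H by (rule H)
  case (Cons s w)
  from Cons obtain v where v: "v \<in> fp_words G H" "fp_eq G H (v @ w) []"
    by (auto simp: fp_words_def)
  show ?case
  proof (cases s)
    case (Inl x)
    with Cons have x: "x \<in> carrier G" and w: "w \<in> fp_words G H" by auto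
    have "fp_eq G H (v @ [Inl (inv\<^bsub>G\<^esub> x), Inl x] @ w) (v @ [Inl \<one>\<^bsub>G\<^esub>] @ w)"
      using fp_multL[OF v(1) w, of "inv\<^bsub>G\<^esub> x" x] x by simp
    from fp_trans[OF fp_trans[OF this fp_oneL[OF v(1) w]] v(2)] show ?thesis
      using x v by (intro bexI[of _ "v @ [Inl (inv\<^bsub>G\<^esub> x)]"]) (auto simp: Inl)
  next
    case (Inr x)
    with Cons have x: "x \<in> carrier H" and w: "w \<in> fp_words G H" by auto
    have "fp_eq G H (v @ [Inr (inv\<^bsub>H\<^esub> x), Inr x] @ w) (v @ [Inr \<one>\<^bsub>H\<^esub>] @ w)"
      using fp_multR[OF v(1) w, of "inv\<^bsub>H\<^esub> x" x] x by simp
    from fp_trans[OF fp_trans[OF this fp_oneR[OF v(1) w]] v(2)] show ?thesis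
      using x v by (intro bexI[of _ "v @ [Inr (inv\<^bsub>H\<^esub> x)]"]) (auto simp: Inr)
  qed
qed

lemma group_free_product: "group (free_product G H)"
proof (rule groupI)
  fix x assume "x \<in> carrier (free_product G H)"
  then obtain w where w: "w \<in> fp_words G H" "x = fp_rel G H `` {w}" by (auto simp: fp_carrier)
  from fp_word_inverse[OF w(1)] obtain v where "v \<in> fp_words G H" "fp_eq G H (v @ w) []" by blast
  then show "\<exists>y\<in>carrier (free_product G H). y \<otimes>\<^bsub>free_product G H\<^esub> x = \<one>\<^bsub>free_product G H\<^esub>"
    using w by (auto simp: fp_carrier fp_mult_class fp_one fp_class_eq_iff)
qed (auto simp: fp_carrier fp_mult_class fp_one)

lemma fp_inl_hom: "fp_inl G H \<in> hom G (free_product G H)"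
proof (rule homI)
  interpret K: group G by (rule G)
  fix x y assume x: "x \<in> carrier G" and y: "y \<in> carrier G"
  show "fp_inl G H x \<in> carrier (free_product G H)"
    using x by (simp add: fp_inl_def fp_carrier)
  have "fp_eq G H [Inl (x \<otimes>\<^bsub>G\<^esub> y)] [Inl x, Inl y]"
    using fp_multL[of "[]" G H "[]" x y] x y by (simp add: fp_sym)
  then have "fp_rel G H `` {[Inl (x \<otimes>\<^bsub>G\<^esub> y)]} = fp_rel G H `` {[Inl x, Inl y]}"
    using x y by (subst fp_class_eq_iff) auto
  then show "fp_inl G H (x \<otimes>\<^bsub>G\<^esub> y) = fp_inl G H x \<otimes>\<^bsub>free_product G H\<^esub> fp_inl G H y"
    using x y by (simp add: fp_inl_def fp_mult_class)
qed

lemma fp_inr_hom: "fp_inr G H \<in> hom H (free_product G H)"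
proof (rule homI)
  interpret K: group H by (rule H)
  fix x y assume x: "x \<in> carrier H" and y: "y \<in> carrier H"
  show "fp_inr G H x \<in> carrier (free_product G H)"
    using x by (simp add: fp_inr_def fp_carrier)
  have "fp_eq G H [Inr (x \<otimes>\<^bsub>H\<^esub> y)] [Inr x, Inr y]"
    using fp_multR[of "[]" G H "[]" x y] x y by (simp add: fp_sym)
  then have "fp_rel G H `` {[Inr (x \<otimes>\<^bsub>H\<^esub> y)]} = fp_rel G H `` {[Inr x, Inr y]}"
    using x y by (subst fp_class_eq_iff) auto
  then show "fp_inr G H (x \<otimes>\<^bsub>H\<^esub> y) = fp_inr G H x \<otimes>\<^bsub>free_product G H\<^esub> fp_inr G H y"
    using x y by (simp add: fp_inr_def fp_mult_class)
qed

lemma fp_induct [consumes 1, case_names one inl inr]: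
  assumes "z \<in> carrier (free_product G H)"
    and one: "P \<one>\<^bsub>free_product G H\<^esub>"
    and inl: "\<And>x z. x \<in> carrier G \<Longrightarrow> z \<in> carrier (free_product G H) \<Longrightarrow> P z \<Longrightarrow>
      P (fp_inl G H x \<otimes>\<^bsub>free_product G H\<^esub> z)"
    and inr: "\<And>y z. y \<in> carrier H \<Longrightarrow> z \<in> carrier (free_product G H) \<Longrightarrow> P z \<Longrightarrow>
      P (fp_inr G H y \<otimes>\<^bsub>free_product G H\<^esub> z)"
  shows "P z"
proof -
  have "w \<in> fp_words G H \<Longrightarrow> P (fp_rel G H `` {w})" for w
  proof (induction w)
    case Nil then show ?case using one by (simp add: fp_one)
  next
    case (Cons s w)
    show ?case
    proof (cases s)
      case (Inl x)
      then show ?thesis using Cons inl[of x "fp_rel G H `` {w}"]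
        by (auto simp: fp_carrier fp_inl_def fp_mult_class)
    next
      case (Inr x)
      then show ?thesis using Cons inr[of x "fp_rel G H `` {w}"]
        by (auto simp: fp_carrier fp_inr_def fp_mult_class)
    qed
  qed
  then show ?thesis using assms(1) by (auto simp: fp_carrier)
qed

lemma free_product_universal:
  fixes K :: "('k, 'e) monoid_scheme"
  assumes K: "group K" and f: "f \<in> hom G K" and h: "h \<in> hom H K"
  shows "\<exists>k \<in> hom (free_product G H) K.
    (\<forall>x\<in>carrier G. k (fp_inl G H x) = f x) \<and> (\<forall>y\<in>carrier H. k (fp_inr G H y) = h y)"
proof -
  interpret G: group G by (rule G)
  interpret H: group H by (rule H)
  interpret K: group K by (rule K)
  interpret f: group_hom G K f by unfold_locales (rule f)
  interpret h: group_hom H K h by unfold_locales (rule h)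
  define ev where "ev = (\<lambda>w. foldr (\<lambda>s z. case_sum f h s \<otimes>\<^bsub>K\<^esub> z) w \<one>\<^bsub>K\<^esub>)"
  have [simp]: "ev [] = \<one>\<^bsub>K\<^esub>" "ev (Inl x # w) = f x \<otimes>\<^bsub>K\<^esub> ev w" "ev (Inr y # w) = h y \<otimes>\<^bsub>K\<^esub> ev w"
    for x y w by (simp_all add: ev_def)
  have ev_closed [simp]: "w \<in> fp_words G H \<Longrightarrow> ev w \<in> carrier K" for w
  proof (induction w)
    case (Cons s w) then show ?case by (cases s) auto
  qed simp
  have ev_append: "u \<in> fp_words G H \<Longrightarrow> v \<in> fp_words G H \<Longrightarrow> ev (u @ v) = ev u \<otimes>\<^bsub>K\<^esub> ev v" for u v
  proof (induction u)
    case (Cons s u) then show ?case by (cases s) (auto simp: K.m_assoc)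
  qed simp
  have ev_eq: "fp_eq G H v w \<Longrightarrow> ev v = ev w" for v w
    by (induction rule: fp_eq.induct) (auto simp: ev_append K.m_assoc)
  define k where "k = (\<lambda>A. ev (SOME w. w \<in> A))"
  have k_class: "k (fp_rel G H `` {w}) = ev w" if "w \<in> fp_words G H" for w
  proof -
    have "w \<in> fp_rel G H `` {w}" using that by (simp add: fp_rel_def fp_refl)
    then have "(SOME v. v \<in> fp_rel G H `` {w}) \<in> fp_rel G H `` {w}" by (rule someI)
    then have "fp_eq G H w (SOME v. v \<in> fp_rel G H `` {w})" by (simp add: fp_rel_def)
    then show ?thesis unfolding k_def using ev_eq by metis
  qed
  have "k \<in> hom (free_product G H) K"
    by (auto simp: hom_def fp_carrier fp_mult_class k_class ev_append)
  moreover have "k (fp_inl G H x) = f x" if "x \<in> carrier G" for x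
    using that by (simp add: fp_inl_def k_class)
  moreover have "k (fp_inr G H y) = h y" if "y \<in> carrier H" for y
    using that by (simp add: fp_inr_def k_class)
  ultimately show ?thesis by blast
qed

lemma free_product_universal_unique:
  assumes K: "group K" and k: "k \<in> hom (free_product G H) K" and l: "l \<in> hom (free_product G H) K"
    and "\<And>x. x \<in> carrier G \<Longrightarrow> k (fp_inl G H x) = l (fp_inl G H x)"
    and "\<And>y. y \<in> carrier H \<Longrightarrow> k (fp_inr G H y) = l (fp_inr G H y)"
    and "z \<in> carrier (free_product G H)"
  shows "k z = l z"
proof -
  have inl: "fp_inl G H x \<in> carrier (free_product G H)" if "x \<in> carrier G" for x
    using fp_inl_hom that by (auto simp: hom_def)
  have inr: "fp_inr G H y \<in> carrier (free_product G H)" if "y \<in> carrier H" for y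
    using fp_inr_hom that by (auto simp: hom_def)
  from \<open>z \<in> carrier (free_product G H)\<close> show ?thesis
  proof (induction rule: fp_induct)
    case one then show ?case using hom_one[OF k group_free_product K] hom_one[OF l group_free_product K] by simp
  next
    case (inl x z) then show ?case using assms(4) hom_mult[OF k] hom_mult[OF l] \<open>x \<in> carrier G \<Longrightarrow> fp_inl G H x \<in> carrier (free_product G H)\<close> by auto
  next
    case (inr y z) then show ?case using assms(5) hom_mult[OF k] hom_mult[OF l] \<open>y \<in> carrier H \<Longrightarrow> fp_inr G H y \<in> carrier (free_product G H)\<close> by auto
  qed
qed

end


section \<open>Coset groups and their growth functions\<close>

text \<open>
  Throughout, \<open>\<phi>\<close> is meant to be an element of \<open>AutoGroup G\<close>, whose elements are the
  automorphisms of \<open>G\<close>, extensional outside the carrier. The cyclic group generated by \<open>\<phi>\<close> acts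
  on \<open>G\<close> by evaluation.
\<close>

definition coset_proj :: "('a, 'c) monoid_scheme \<Rightarrow> ('a \<Rightarrow> 'a) \<Rightarrow> 'a \<Rightarrow> 'a set"
  where "coset_proj G \<phi> = orbit (subgroup_generated (AutoGroup G) {\<phi>}) (\<lambda>\<sigma>. \<sigma>)"

definition coset_space :: "('a, 'c) monoid_scheme \<Rightarrow> ('a \<Rightarrow> 'a) \<Rightarrow> 'a set set"
  where "coset_space G \<phi> = orbits (subgroup_generated (AutoGroup G) {\<phi>}) (carrier G) (\<lambda>\<sigma>. \<sigma>)"

text \<open>
  Elements of \<open>coset_space G \<phi>\<close> are orbits, so the fibre of the quotient map over \<open>x\<close> is
  \<open>x\<close> itself; independence of the chosen representatives is \<open>coset_mult_eq\<close> below.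
\<close>

definition coset_mult :: "('a, 'c) monoid_scheme \<Rightarrow> ('a \<Rightarrow> 'a) \<Rightarrow> 'a set \<Rightarrow> 'a set \<Rightarrow> 'a set multiset"
  where "coset_mult G \<phi> x y =
    (let u = (SOME u. u \<in> x); v = (SOME v. v \<in> y); n = group.ord (AutoGroup G) \<phi>
     in {# coset_proj G \<phi> (u \<otimes>\<^bsub>G\<^esub> (\<phi> ^^ i) v). i \<in># mset_set {0..<n} #})"

definition coset_unit :: "('a, 'c) monoid_scheme \<Rightarrow> ('a \<Rightarrow> 'a) \<Rightarrow> 'a set"
  where "coset_unit G \<phi> = coset_proj G \<phi> \<one>\<^bsub>G\<^esub>"

text \<open>
  The exponent 0 is a totalisation only; the growth function uses exponents at least 1 and
  adds the unit separately.
\<close>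

fun coset_pow :: "('a, 'c) monoid_scheme \<Rightarrow> ('a \<Rightarrow> 'a) \<Rightarrow> 'a set \<Rightarrow> nat \<Rightarrow> 'a set multiset"
  where
    "coset_pow G \<phi> g 0 = {# coset_unit G \<phi> #}"
  | "coset_pow G \<phi> g (Suc 0) = {# g #}"
  | "coset_pow G \<phi> g (Suc (Suc k)) = (\<Sum>x\<in>#coset_pow G \<phi> g (Suc k). coset_mult G \<phi> g x)"

definition coset_growth :: "('a, 'c) monoid_scheme \<Rightarrow> ('a \<Rightarrow> 'a) \<Rightarrow> 'a set \<Rightarrow> nat \<Rightarrow> nat"
  where "coset_growth G \<phi> g k =
    card ({coset_unit G \<phi>} \<union> (\<Union>i\<in>{1..k}. set_mset (coset_pow G \<phi> g i)))"

context
  fixes G :: "('a, 'c) monoid_scheme" (structure) and \<phi> :: "'a \<Rightarrow> 'a"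
  assumes G: "group G" and \<phi>: "\<phi> \<in> carrier (AutoGroup G)"
begin

lemma AutoGroup_pow_apply:
  assumes "v \<in> carrier G" shows "(\<phi> [^]\<^bsub>AutoGroup G\<^esub> (i::nat)) v = (\<phi> ^^ i) v"
proof -
  interpret A: group "AutoGroup G" by (rule group.AutoGroup[OF G])
  have bij: "\<sigma> \<in> Bij (carrier G)" if "\<sigma> \<in> carrier (AutoGroup G)" for \<sigma>
    using that by (simp add: AutoGroup_def auto_def)
  show ?thesis
    using assms
  proof (induction i arbitrary: v)
    case 0 then show ?case by (simp add: AutoGroup_def BijGroup_def)
  next
    case (Suc i)
    have "\<phi> v \<in> carrier G" using Bij_imp_funcset[OF bij[OF \<phi>]] Suc.prems by auto
    moreover have "(\<phi> [^]\<^bsub>AutoGroup G\<^esub> Suc i) v = (\<phi> [^]\<^bsub>AutoGroup G\<^esub> i) (\<phi> v)"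
      using bij[OF \<phi>] bij[OF A.nat_pow_closed[OF \<phi>, of i]] Suc.prems
      by (simp add: AutoGroup_def BijGroup_def compose_def)
    ultimately show ?case using Suc.IH by (simp add: funpow_swap1)
  qed
qed

lemma iter_closed: "v \<in> carrier G \<Longrightarrow> (\<phi> ^^ i) v \<in> carrier G"
  using \<phi> by (induction i) (auto simp: AutoGroup_def auto_def hom_def)

lemma iter_mult:
  assumes "u \<in> carrier G" "v \<in> carrier G"
  shows "(\<phi> ^^ i) (u \<otimes> v) = (\<phi> ^^ i) u \<otimes> (\<phi> ^^ i) v"
  using assms \<phi> iter_closed by (induction i) (auto simp: AutoGroup_def auto_def hom_def)

context
  assumes n: "group.ord (AutoGroup G) \<phi> > 0"
begin

lemma iter_ord: "v \<in> carrier G \<Longrightarrow> (\<phi> ^^ group.ord (AutoGroup G) \<phi>) v = v"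
  using AutoGroup_pow_apply[of v "group.ord (AutoGroup G) \<phi>"]
    group.pow_ord_eq_1[OF group.AutoGroup[OF G] \<phi>]
  by (simp add: AutoGroup_def BijGroup_def)

lemma iter_mod:
  assumes "v \<in> carrier G" shows "(\<phi> ^^ (i mod group.ord (AutoGroup G) \<phi>)) v = (\<phi> ^^ i) v"
  by (rule funpow_mod_eq[OF iter_ord[OF assms]])

lemma coset_proj_eq:
  assumes "v \<in> carrier G"
  shows "coset_proj G \<phi> v = (\<lambda>i. (\<phi> ^^ i) v) ` {0..<group.ord (AutoGroup G) \<phi>}"
proof -
  interpret A: group "AutoGroup G" by (rule group.AutoGroup[OF G])
  let ?n = "group.ord (AutoGroup G) \<phi>"
  have "carrier (subgroup_generated (AutoGroup G) {\<phi>}) = range (\<lambda>i::int. \<phi> [^]\<^bsub>AutoGroup G\<^esub> i)"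
    by (rule A.carrier_subgroup_generated_by_singleton[OF \<phi>])
  also have "\<dots> = (\<lambda>i::nat. \<phi> [^]\<^bsub>AutoGroup G\<^esub> i) ` {0..<?n}"
  proof (intro subset_antisym subsetI)
    fix z assume "z \<in> range (\<lambda>i::int. \<phi> [^]\<^bsub>AutoGroup G\<^esub> i)"
    then obtain i :: int where i: "z = \<phi> [^]\<^bsub>AutoGroup G\<^esub> i" by auto
    define j where "j = nat (i mod int ?n)"
    have ij: "int j = i mod int ?n" using n by (simp add: j_def)
    have "\<phi> [^]\<^bsub>AutoGroup G\<^esub> i = \<phi> [^]\<^bsub>AutoGroup G\<^esub> (int ?n * (i div int ?n) + int j)"
      by (simp add: ij)
    also have "\<dots> = (\<phi> [^]\<^bsub>AutoGroup G\<^esub> (int ?n)) [^]\<^bsub>AutoGroup G\<^esub> (i div int ?n) \<otimes>\<^bsub>AutoGroup G\<^esub> \<phi> [^]\<^bsub>AutoGroup G\<^esub> int j"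
      using \<phi> by (simp add: A.int_pow_mult A.int_pow_pow)
    also have "\<dots> = \<phi> [^]\<^bsub>AutoGroup G\<^esub> j"
      using \<phi> by (simp add: int_pow_int)
    finally show "z \<in> (\<lambda>i::nat. \<phi> [^]\<^bsub>AutoGroup G\<^esub> i) ` {0..<?n}"
      using n i by (auto simp: j_def nat_less_iff intro!: image_eqI[of _ _ j])
  next
    fix z assume "z \<in> (\<lambda>i::nat. \<phi> [^]\<^bsub>AutoGroup G\<^esub> i) ` {0..<?n}"
    then show "z \<in> range (\<lambda>i::int. \<phi> [^]\<^bsub>AutoGroup G\<^esub> i)"
      by (auto intro: range_eqI[of _ _ "int _"] simp: int_pow_int)
  qed
  finally have c: "carrier (subgroup_generated (AutoGroup G) {\<phi>}) =
    (\<lambda>i::nat. \<phi> [^]\<^bsub>AutoGroup G\<^esub> i) ` {0..<?n}" .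
  have "coset_proj G \<phi> v = (\<lambda>\<sigma>. \<sigma> v) ` carrier (subgroup_generated (AutoGroup G) {\<phi>})"
    by (auto simp: coset_proj_def orbit_def)
  also have "\<dots> = (\<lambda>i. (\<phi> ^^ i) v) ` {0..<?n}"
    unfolding c image_image by (simp add: AutoGroup_pow_apply[OF assms])
  finally show ?thesis .
qed

lemma coset_proj_iter:
  assumes "v \<in> carrier G" shows "coset_proj G \<phi> ((\<phi> ^^ j) v) = coset_proj G \<phi> v"
proof -
  let ?n = "group.ord (AutoGroup G) \<phi>"
  have all: "coset_proj G \<phi> w = range (\<lambda>i. (\<phi> ^^ i) w)" if w: "w \<in> carrier G" for w
    using n iter_mod[OF w] by (fastforce simp: coset_proj_eq[OF w] image_iff
        intro: bexI[of _ "_ mod ?n"] mod_less_divisor)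
  have "(\<phi> ^^ i) v \<in> range (\<lambda>i. (\<phi> ^^ i) ((\<phi> ^^ j) v))" for i
  proof -
    have "j \<le> ?n * j" using n by (cases ?n) auto
    then have "i + (?n * j - j) + j = i + ?n * j" by linarith
    then have "(\<phi> ^^ (i + (?n * j - j))) ((\<phi> ^^ j) v) = (\<phi> ^^ (i + ?n * j)) v"
      using fun_cong[OF funpow_add[of "i + (?n * j - j)" j \<phi>], of v] by (metis comp_apply)
    also have "\<dots> = (\<phi> ^^ i) v"
      using iter_mod[OF assms, of "i + ?n * j"] iter_mod[OF assms, of i] by simp
    finally show ?thesis by (metis rangeI)
  qed
  then show ?thesis
    using all[OF assms] all[OF iter_closed[OF assms, of j]]
    by (auto simp flip: funpow_add[THEN fun_cong, unfolded comp_apply])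
qed

lemma coset_space_eq: "coset_space G \<phi> = coset_proj G \<phi> ` carrier G"
  by (auto simp: coset_space_def orbits_def coset_proj_def)

lemma coset_mult_eq:
  assumes x: "x \<in> coset_space G \<phi>" "u \<in> x" and y: "y \<in> coset_space G \<phi>" "v \<in> y"
  shows "coset_mult G \<phi> x y =
    {# coset_proj G \<phi> (u \<otimes> (\<phi> ^^ i) v). i \<in># mset_set {0..<group.ord (AutoGroup G) \<phi>} #}"
proof -
  interpret G: group G by (rule G)
  let ?n = "group.ord (AutoGroup G) \<phi>"
  let ?M = "\<lambda>u v. {# coset_proj G \<phi> (u \<otimes> (\<phi> ^^ i) v). i \<in># mset_set {0..<?n} #}"
  have indep: "?M ((\<phi> ^^ j) u) ((\<phi> ^^ k) v) = ?M u v"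
    if u: "u \<in> carrier G" and v: "v \<in> carrier G" and j: "j < ?n" for u v j k
  proof -
    let ?s = "\<lambda>i. (i + (k + (?n - j))) mod ?n"
    have "inj_on ?s {0..<?n}"
    proof (rule inj_onI)
      fix a b assume "a \<in> {0..<?n}" "b \<in> {0..<?n}" "?s a = ?s b"
      then have "a mod ?n = b mod ?n" using cong_def cong_add_rcancel_nat by blast
      then show "a = b" using \<open>a \<in> _\<close> \<open>b \<in> _\<close> by simp
    qed
    moreover have "?s ` {0..<?n} \<subseteq> {0..<?n}" using n by auto
    ultimately have bij: "bij_betw ?s {0..<?n} {0..<?n}"
      by (simp add: bij_betw_def endo_inj_surj)
    have eq: "coset_proj G \<phi> ((\<phi> ^^ j) u \<otimes> (\<phi> ^^ i) ((\<phi> ^^ k) v)) =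
        coset_proj G \<phi> (u \<otimes> (\<phi> ^^ ?s i) v)" for i
    proof -
      have "(\<phi> ^^ j) ((\<phi> ^^ ?s i) v) = (\<phi> ^^ j) ((\<phi> ^^ (i + (k + (?n - j)))) v)"
        by (simp only: iter_mod[OF v])
      also have "\<dots> = (\<phi> ^^ (i + k + ?n)) v"
      proof -
        have "j + (i + (k + (?n - j))) = i + k + ?n" using j by simp
        then show ?thesis using fun_cong[OF funpow_add[of j "i + (k + (?n - j))" \<phi>], of v]
          by (metis comp_apply)
      qed
      also have "\<dots> = (\<phi> ^^ i) ((\<phi> ^^ k) v)"
        by (simp add: funpow_add iter_ord[OF v])
      finally have "(\<phi> ^^ j) u \<otimes> (\<phi> ^^ i) ((\<phi> ^^ k) v) = (\<phi> ^^ j) (u \<otimes> (\<phi> ^^ ?s i) v)"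
        using u v by (simp add: iter_mult iter_closed)
      then show ?thesis using u v by (simp add: coset_proj_iter iter_closed)
    qed
    have "?M ((\<phi> ^^ j) u) ((\<phi> ^^ k) v) =
        image_mset (\<lambda>i. coset_proj G \<phi> (u \<otimes> (\<phi> ^^ i) v)) (image_mset ?s (mset_set {0..<?n}))"
      by (simp add: eq image_mset.compositionality comp_def)
    also have "image_mset ?s (mset_set {0..<?n}) = mset_set {0..<?n}"
      using bij by (simp add: image_mset_mset_set bij_betw_def)
    finally show ?thesis .
  qed
  obtain u0 where u0: "u0 \<in> carrier G" "x = (\<lambda>i. (\<phi> ^^ i) u0) ` {0..<?n}"
    using x by (auto simp: coset_space_eq coset_proj_eq)
  obtain v0 where v0: "v0 \<in> carrier G" "y = (\<lambda>i. (\<phi> ^^ i) v0) ` {0..<?n}"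
    using y by (auto simp: coset_space_eq coset_proj_eq)
  have all: "?M u' v' = ?M u0 v0" if "u' \<in> x" "v' \<in> y" for u' v'
    using that u0 v0 indep[OF u0(1) v0(1)] by auto
  have "coset_mult G \<phi> x y = ?M (SOME u. u \<in> x) (SOME v. v \<in> y)"
    by (simp add: coset_mult_def)
  also have "\<dots> = ?M u v"
    using all[OF someI[of "\<lambda>u. u \<in> x", OF x(2)] someI[of "\<lambda>v. v \<in> y", OF y(2)]] all[OF x(2) y(2)]
    by simp
  finally show ?thesis .
qed

end

end


section \<open>The group \<open>\<int>/3 * \<int>/3\<close>\<close>

definition Z3Z3 :: "(int + int) list set monoid"
  where "Z3Z3 = free_product (integer_mod_group 3) (integer_mod_group 3)"

definition gen_a :: "(int + int) list set"
  where "gen_a = fp_inl (integer_mod_group 3) (integer_mod_group 3) 1"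

definition gen_b :: "(int + int) list set"
  where "gen_b = fp_inr (integer_mod_group 3) (integer_mod_group 3) 1"

lemma group_Z3Z3: "group Z3Z3"
  by (simp add: Z3Z3_def group_free_product)

lemma gen_closed: "gen_a \<in> carrier Z3Z3" "gen_b \<in> carrier Z3Z3"
  using fp_inl_hom[of "integer_mod_group 3" "integer_mod_group 3"]
    fp_inr_hom[of "integer_mod_group 3" "integer_mod_group 3"]
  by (auto simp: gen_a_def gen_b_def Z3Z3_def hom_def)

lemma fp_inl_Z3: "x \<in> {0..<3} \<Longrightarrow>
    fp_inl (integer_mod_group 3) (integer_mod_group 3) x = gen_a [^]\<^bsub>Z3Z3\<^esub> nat x"
  using group_hom.hom_nat_pow[of "integer_mod_group 3" Z3Z3 "fp_inl (integer_mod_group 3) (integer_mod_group 3)" 1 "nat x"]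
    fp_inl_hom[of "integer_mod_group 3" "integer_mod_group 3"]
  by (simp add: group_hom_def group_hom_axioms_def group_Z3Z3 Z3Z3_def[symmetric] gen_a_def)

lemma fp_inr_Z3: "x \<in> {0..<3} \<Longrightarrow>
    fp_inr (integer_mod_group 3) (integer_mod_group 3) x = gen_b [^]\<^bsub>Z3Z3\<^esub> nat x"
  using group_hom.hom_nat_pow[of "integer_mod_group 3" Z3Z3 "fp_inr (integer_mod_group 3) (integer_mod_group 3)" 1 "nat x"]
    fp_inr_hom[of "integer_mod_group 3" "integer_mod_group 3"]
  by (simp add: group_hom_def group_hom_axioms_def group_Z3Z3 Z3Z3_def[symmetric] gen_b_def)

text \<open>
  The lemmas \<open>gen_cubes\<close>, \<open>generate_gens\<close> and \<open>Z3Z3_universal\<close> together say that this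
  group has the presentation \<open>\<langle>a, b | a^3 = b^3 = 1\<rangle>\<close>.
\<close>

lemma gen_cubes: "gen_a [^]\<^bsub>Z3Z3\<^esub> (3::nat) = \<one>\<^bsub>Z3Z3\<^esub>" "gen_b [^]\<^bsub>Z3Z3\<^esub> (3::nat) = \<one>\<^bsub>Z3Z3\<^esub>"
proof -
  let ?Z = "integer_mod_group 3"
  interpret l: group_hom ?Z Z3Z3 "fp_inl ?Z ?Z"
    using fp_inl_hom[of ?Z ?Z] by (simp add: group_hom_def group_hom_axioms_def group_Z3Z3 Z3Z3_def[symmetric])
  interpret r: group_hom ?Z Z3Z3 "fp_inr ?Z ?Z"
    using fp_inr_hom[of ?Z ?Z] by (simp add: group_hom_def group_hom_axioms_def group_Z3Z3 Z3Z3_def[symmetric])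
  show "gen_a [^]\<^bsub>Z3Z3\<^esub> (3::nat) = \<one>\<^bsub>Z3Z3\<^esub>"
    using l.hom_nat_pow[of 1 3] l.hom_one by (simp add: gen_a_def)
  show "gen_b [^]\<^bsub>Z3Z3\<^esub> (3::nat) = \<one>\<^bsub>Z3Z3\<^esub>"
    using r.hom_nat_pow[of 1 3] r.hom_one by (simp add: gen_b_def)
qed

lemma generate_gens: "generate Z3Z3 {gen_a, gen_b} = carrier Z3Z3"
proof
  let ?Z = "integer_mod_group 3"
  interpret group Z3Z3 by (rule group_Z3Z3)
  show "generate Z3Z3 {gen_a, gen_b} \<subseteq> carrier Z3Z3"
    by (rule generate_incl) (simp add: gen_closed)
  have pow: "x [^]\<^bsub>Z3Z3\<^esub> (m::nat) \<in> generate Z3Z3 {gen_a, gen_b}" if "x \<in> {gen_a, gen_b}" for x m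
    using that by (induction m) (auto intro: generate.intros)
  have gZ: "group ?Z" by simp
  show "carrier Z3Z3 \<subseteq> generate Z3Z3 {gen_a, gen_b}"
  proof
    fix z assume "z \<in> carrier Z3Z3"
    then have "z \<in> carrier (free_product ?Z ?Z)" by (simp add: Z3Z3_def)
    then show "z \<in> generate Z3Z3 {gen_a, gen_b}"
    proof (rule fp_induct[OF gZ gZ, where P = "\<lambda>z. z \<in> generate Z3Z3 {gen_a, gen_b}"],
        unfold Z3Z3_def[symmetric])
      show "\<one>\<^bsub>Z3Z3\<^esub> \<in> generate Z3Z3 {gen_a, gen_b}" by (rule generate.one)
    next
      fix x z assume "x \<in> carrier ?Z" "z \<in> generate Z3Z3 {gen_a, gen_b}"
      then show "fp_inl ?Z ?Z x \<otimes>\<^bsub>Z3Z3\<^esub> z \<in> generate Z3Z3 {gen_a, gen_b}"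
        using fp_inl_Z3[of x] pow[of gen_a "nat x"]
        by (simp only: carrier_integer_mod_group) (auto intro: generate.eng)
    next
      fix x z assume "x \<in> carrier ?Z" "z \<in> generate Z3Z3 {gen_a, gen_b}"
      then show "fp_inr ?Z ?Z x \<otimes>\<^bsub>Z3Z3\<^esub> z \<in> generate Z3Z3 {gen_a, gen_b}"
        using fp_inr_Z3[of x] pow[of gen_b "nat x"]
        by (simp only: carrier_integer_mod_group) (auto intro: generate.eng)
    qed
  qed
qed

lemma Z3_hom:
  assumes K: "group K" and x: "x \<in> carrier K" "x [^]\<^bsub>K\<^esub> (3::nat) = \<one>\<^bsub>K\<^esub>"
  shows "(\<lambda>i. x [^]\<^bsub>K\<^esub> nat i) \<in> hom (integer_mod_group 3) K"
proof -
  interpret K: group K by (rule K)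
  have "x [^]\<^bsub>K\<^esub> nat ((i + j) mod 3) = x [^]\<^bsub>K\<^esub> nat i \<otimes>\<^bsub>K\<^esub> x [^]\<^bsub>K\<^esub> nat j"
    if ij: "0 \<le> i" "0 \<le> j" for i j :: int
  proof -
    have "nat i + nat j = 3 * nat ((i + j) div 3) + nat ((i + j) mod 3)"
      using ij by (simp add: nat_div_distrib nat_mod_distrib flip: nat_add_distrib)
    then have "x [^]\<^bsub>K\<^esub> (nat i + nat j) =
        (x [^]\<^bsub>K\<^esub> (3::nat)) [^]\<^bsub>K\<^esub> nat ((i + j) div 3) \<otimes>\<^bsub>K\<^esub> x [^]\<^bsub>K\<^esub> nat ((i + j) mod 3)"
      using x(1) by (metis K.nat_pow_mult K.nat_pow_pow)
    then show ?thesis using x by (simp add: K.nat_pow_mult)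
  qed
  then show ?thesis using x by (auto simp: hom_def carrier_integer_mod_group)
qed

lemma Z3Z3_universal:
  assumes K: "group K" and x: "x \<in> carrier K" "x [^]\<^bsub>K\<^esub> (3::nat) = \<one>\<^bsub>K\<^esub>"
    and y: "y \<in> carrier K" "y [^]\<^bsub>K\<^esub> (3::nat) = \<one>\<^bsub>K\<^esub>"
  shows "\<exists>h \<in> hom Z3Z3 K. h gen_a = x \<and> h gen_b = y"
proof -
  let ?Z = "integer_mod_group 3"
  interpret K: group K by (rule K)
  have gZ: "group ?Z" by simp
  have 1: "1 \<in> carrier ?Z" by simp
  from free_product_universal[OF gZ gZ K Z3_hom[OF K x] Z3_hom[OF K y]] obtain h
    where h: "h \<in> hom (free_product ?Z ?Z) K"
      "\<forall>i\<in>carrier ?Z. h (fp_inl ?Z ?Z i) = x [^]\<^bsub>K\<^esub> nat i"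
      "\<forall>i\<in>carrier ?Z. h (fp_inr ?Z ?Z i) = y [^]\<^bsub>K\<^esub> nat i" by blast
  have "h gen_a = x" "h gen_b = y"
    using h(2)[rule_format, OF 1] h(3)[rule_format, OF 1] x y by (simp_all add: gen_a_def gen_b_def)
  with h(1) show ?thesis unfolding Z3Z3_def by blast
qed

lemma gen_neq: "gen_a \<noteq> gen_b"
proof
  assume "gen_a = gen_b"
  moreover have "\<exists>h \<in> hom Z3Z3 (integer_mod_group 3). h gen_a = 1 \<and> h gen_b = 0"
    by (rule Z3Z3_universal) (auto simp: carrier_integer_mod_group)
  ultimately show False by auto
qed

lemma Z3Z3_hom_eqI:
  assumes K: "group K" and "k \<in> hom Z3Z3 K" "l \<in> hom Z3Z3 K" "k gen_a = l gen_a" "k gen_b = l gen_b"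
    "z \<in> carrier Z3Z3"
  shows "k z = l z"
proof -
  interpret k: group_hom Z3Z3 K k using assms group_Z3Z3 by (simp add: group_hom_def group_hom_axioms_def)
  interpret l: group_hom Z3Z3 K l using assms group_Z3Z3 by (simp add: group_hom_def group_hom_axioms_def)
  have gens: "gen_a \<in> carrier Z3Z3" "gen_b \<in> carrier Z3Z3" by (rule gen_closed)+
  have cl: "w \<in> carrier Z3Z3" if "w \<in> generate Z3Z3 {gen_a, gen_b}" for w
    using that by (simp add: generate_gens)
  from \<open>z \<in> carrier Z3Z3\<close> have "z \<in> generate Z3Z3 {gen_a, gen_b}" by (simp add: generate_gens)
  then show ?thesis
  proof (induction rule: generate.induct)
    case one then show ?case by simp
  next
    case (incl h) then show ?case using assms by auto
  next
    case (inv h) then show ?case using assms gens by auto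
  next
    case (eng h1 h2) then show ?case using cl by simp
  qed
qed

lemma ex1_swap:
  "\<exists>!\<phi>. \<phi> \<in> carrier (AutoGroup Z3Z3) \<and> \<phi> gen_a = gen_b \<and> \<phi> gen_b = gen_a"
proof -
  interpret group Z3Z3 by (rule group_Z3Z3)
  obtain h where h: "h \<in> hom Z3Z3 Z3Z3" "h gen_a = gen_b" "h gen_b = gen_a"
    using Z3Z3_universal[OF group_Z3Z3 gen_closed(2) gen_cubes(2) gen_closed(1) gen_cubes(1)] by blast
  have hc: "h z \<in> carrier Z3Z3" if "z \<in> carrier Z3Z3" for z using h(1) that by (auto simp: hom_def)
  have hh: "h (h z) = z" if "z \<in> carrier Z3Z3" for z
  proof (rule Z3Z3_hom_eqI[OF group_Z3Z3, of "\<lambda>z. h (h z)" "\<lambda>z. z"])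
    show "(\<lambda>z. h (h z)) \<in> hom Z3Z3 Z3Z3" using h(1) by (auto simp: hom_def Pi_iff)
  qed (use h that in \<open>auto simp: hom_def\<close>)
  have "bij_betw h (carrier Z3Z3) (carrier Z3Z3)"
    by (rule bij_betw_byWitness[of _ h]) (auto simp: hh hc)
  then have "restrict h (carrier Z3Z3) \<in> carrier (AutoGroup Z3Z3)"
    using h(1) by (auto simp: AutoGroup_def auto_def Bij_def hom_def)
  moreover have "\<phi> = \<psi>"
    if "\<phi> \<in> carrier (AutoGroup Z3Z3) \<and> \<phi> gen_a = gen_b \<and> \<phi> gen_b = gen_a"
      and "\<psi> \<in> carrier (AutoGroup Z3Z3) \<and> \<psi> gen_a = gen_b \<and> \<psi> gen_b = gen_a" for \<phi> \<psi>
  proof (rule extensionalityI[of _ "carrier Z3Z3"])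
    fix z assume "z \<in> carrier Z3Z3"
    moreover have "\<phi> \<in> hom Z3Z3 Z3Z3" "\<psi> \<in> hom Z3Z3 Z3Z3"
      using that by (auto simp: AutoGroup_def auto_def)
    ultimately show "\<phi> z = \<psi> z"
      using Z3Z3_hom_eqI[OF group_Z3Z3, of \<phi> \<psi> z] that by simp
  qed (use that in \<open>auto simp: AutoGroup_def auto_def Bij_def\<close>)
  ultimately show ?thesis
    using h gen_closed by (intro ex1I[of _ "restrict h (carrier Z3Z3)"]) auto
qed

lemma swap_ord:
  assumes \<phi>: "\<phi> \<in> carrier (AutoGroup Z3Z3)" and ab: "\<phi> gen_a = gen_b" "\<phi> gen_b = gen_a"
  shows "group.ord (AutoGroup Z3Z3) \<phi> = 2"
proof -
  interpret A: group "AutoGroup Z3Z3" by (rule group.AutoGroup[OF group_Z3Z3])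
  have hom: "\<phi> \<in> hom Z3Z3 Z3Z3" and bij: "\<phi> \<in> Bij (carrier Z3Z3)"
    using \<phi> by (auto simp: AutoGroup_def auto_def)
  have one: "\<one>\<^bsub>AutoGroup Z3Z3\<^esub> = (\<lambda>z\<in>carrier Z3Z3. z)" by (simp add: AutoGroup_def BijGroup_def)
  have pp: "\<phi> (\<phi> z) = z" if "z \<in> carrier Z3Z3" for z
  proof (rule Z3Z3_hom_eqI[OF group_Z3Z3, of "\<lambda>z. \<phi> (\<phi> z)" "\<lambda>z. z"])
    show "(\<lambda>z. \<phi> (\<phi> z)) \<in> hom Z3Z3 Z3Z3" using hom by (auto simp: hom_def Pi_iff)
  qed (use ab that in \<open>auto simp: hom_def\<close>)
  have "\<phi> \<otimes>\<^bsub>AutoGroup Z3Z3\<^esub> \<phi> = \<one>\<^bsub>AutoGroup Z3Z3\<^esub>"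
    using bij pp by (simp add: AutoGroup_def BijGroup_def compose_def cong: restrict_cong)
  then have "\<phi> [^]\<^bsub>AutoGroup Z3Z3\<^esub> (2::nat) = \<one>\<^bsub>AutoGroup Z3Z3\<^esub>"
    using \<phi> by (simp add: numeral_2_eq_2)
  then have "A.ord \<phi> dvd 2" using \<phi> by (simp add: A.pow_eq_id)
  then have "A.ord \<phi> = 1 \<or> A.ord \<phi> = 2" using prime_nat_iff two_is_prime_nat by blast
  moreover have "A.ord \<phi> \<noteq> 1"
  proof
    assume "A.ord \<phi> = 1"
    then have "\<phi> = \<one>\<^bsub>AutoGroup Z3Z3\<^esub>" using A.pow_ord_eq_1[OF \<phi>] \<phi> by simp
    then show False using ab gen_neq gen_closed by (simp add: one)
  qed
  ultimately show ?thesis by blast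
qed

lemma coset_proj_gen_a:
  assumes "\<phi> \<in> carrier (AutoGroup Z3Z3)" "\<phi> gen_a = gen_b" "\<phi> gen_b = gen_a"
  shows "coset_proj Z3Z3 \<phi> gen_a = {gen_a, gen_b}"
proof -
  have "{0..<2::nat} = {0, 1}" by auto
  then show ?thesis
    using coset_proj_eq[OF group_Z3Z3 assms(1) _ gen_closed(1)] swap_ord[OF assms] assms(2) by simp
qed

end

theory Submission
  imports Defs
begin

text \<open>
  Since \<open>\<pi>(a \<phi>(v)) = \<pi>(b v)\<close>, the support of \<open>g\<^sup>k\<close> is the image under \<open>\<pi>\<close> of the products of
  \<open>k\<close> generators. Letting \<open>a\<close> and \<open>b\<close> act on the words without three equal consecutive letters
  shows that such words are unique normal forms, and deleting cubes only shortens words. Hence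
  \<open>\<xi>\<^sub>k\<close> counts the normal forms of length at most \<open>k\<close> up to interchanging the letters, that is,
  those that are empty or start with \<open>a\<close>. Splitting off the first syllable, \<open>a\<close> or \<open>aa\<close>, shows
  that their number of length \<open>m\<close> is the Fibonacci number \<open>F\<^sub>m\<^sub>+\<^sub>1\<close>.
\<close>

section \<open>Cube-free words in two letters\<close>

fun cube_free :: "bool list \<Rightarrow> bool" where
  "cube_free (x # y # z # w) \<longleftrightarrow> \<not> (x = y \<and> y = z) \<and> cube_free (y # z # w)"
| "cube_free _ \<longleftrightarrow> True"

text \<open>Models left multiplication by a generator of order 3 on normal forms.\<close>

fun push :: "bool \<Rightarrow> bool list \<Rightarrow> bool list" where
  "push c (x # y # w) = (if c = x \<and> c = y then w else c # x # y # w)"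
| "push c w = c # w"

lemma cube_free_tl: "cube_free (x # w) \<Longrightarrow> cube_free w"
  by (cases "x # w" rule: cube_free.cases) auto

lemma cube_free_map_Not: "cube_free (map Not w) = cube_free w"
  by (induction w rule: cube_free.induct) auto

lemma cube_free_push: "cube_free w \<Longrightarrow> cube_free (push c w)"
  by (cases "(c, w)" rule: push.cases) (auto dest: cube_free_tl)

lemma push_cube_free: "cube_free (c # w) \<Longrightarrow> push c w = c # w"
  by (cases "(c, w)" rule: push.cases) auto

text \<open>A cube-free word starts with at most two letters \<open>c\<close>, so exactly one of
  three pushes cancels. This is the relation \<open>c^3 = 1\<close> for the action.\<close>

lemma push_push_push: "cube_free w \<Longrightarrow> push c (push c (push c w)) = w"
proof (cases w rule: cube_free.cases)
  case (1 x y z v)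
  then show "cube_free w \<Longrightarrow> ?thesis" by (cases v) auto
qed auto

lemma length_push: "length (push c w) \<le> Suc (length w)"
  by (cases "(c, w)" rule: push.cases) auto

text \<open>Folding \<open>push\<close> over an arbitrary word computes its normal form.\<close>

lemma cube_free_foldr_push: "cube_free (foldr push w [])"
  by (induction w) (auto intro: cube_free_push)

lemma length_foldr_push: "length (foldr push w []) \<le> length w"
  by (induction w) (auto intro: order_trans[OF length_push])

lemma foldr_push_cube_free: "cube_free w \<Longrightarrow> foldr push w [] = w"
proof (induction w)
  case (Cons c w)
  then show ?case using push_cube_free[of c w] cube_free_tl[of c w] by simp
qed simp

section \<open>Counting normal forms by length and first letter\<close>

definition cube_free_from :: "bool \<Rightarrow> nat \<Rightarrow> bool list set"
  where "cube_free_from c m = {w. cube_free w \<and> length w = m \<and> (w \<noteq> [] \<longrightarrow> hd w = c)}"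

text \<open>The condition on the first letter is vacuous for the empty word, which thus counts for
  either \<open>c\<close>.\<close>

lemma cube_free_from_0: "cube_free_from c 0 = {[]}"
  by (auto simp: cube_free_from_def)

lemma cube_free_from_1: "cube_free_from c (Suc 0) = {[c]}"
  by (auto simp: cube_free_from_def length_Suc_conv)

lemma cube_free_Cons_Cons_neq: "x \<noteq> c \<Longrightarrow> cube_free (c # x # v) \<longleftrightarrow> cube_free (x # v)"
  by (cases v) auto

lemma cube_free_Cons_Cons_same:
  "cube_free (c # c # v) \<longleftrightarrow> cube_free v \<and> (v \<noteq> [] \<longrightarrow> hd v = (\<not> c))"
  by (cases v) (auto simp: cube_free_Cons_Cons_neq)

text \<open>The first syllable is \<open>c\<close> or \<open>cc\<close>. What follows starts with
  the other letter or, after \<open>cc\<close> with \<open>m = 0\<close>, is empty.\<close>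

lemma cube_free_from_Suc_Suc:
  "cube_free_from c (Suc (Suc m)) =
    (#) c ` cube_free_from (\<not> c) (Suc m) \<union> (\<lambda>w. c # c # w) ` cube_free_from (\<not> c) m"
proof (intro subset_antisym subsetI)
  fix w assume w: "w \<in> cube_free_from c (Suc (Suc m))"
  then obtain x v where v: "w = c # x # v" "length v = m" "cube_free (c # x # v)"
    by (auto simp: cube_free_from_def length_Suc_conv)
  show "w \<in> (#) c ` cube_free_from (\<not> c) (Suc m) \<union> (\<lambda>w. c # c # w) ` cube_free_from (\<not> c) m"
  proof (cases "x = c")
    case True
    then have "v \<in> cube_free_from (\<not> c) m"
      using v by (simp add: cube_free_from_def cube_free_Cons_Cons_same)
    then show ?thesis using v True by blast
  next
    case False
    then have "x # v \<in> cube_free_from (\<not> c) (Suc m)"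
      using v by (simp add: cube_free_from_def cube_free_Cons_Cons_neq)
    then show ?thesis using v by blast
  qed
next
  fix w
  assume "w \<in> (#) c ` cube_free_from (\<not> c) (Suc m) \<union> (\<lambda>w. c # c # w) ` cube_free_from (\<not> c) m"
  then show "w \<in> cube_free_from c (Suc (Suc m))"
  proof
    assume "w \<in> (#) c ` cube_free_from (\<not> c) (Suc m)"
    then obtain v where v: "w = c # v" "v \<in> cube_free_from (\<not> c) (Suc m)" by blast
    then obtain u where "v = (\<not> c) # u"
      by (auto simp: cube_free_from_def length_Suc_conv)
    then show ?thesis using v by (simp add: cube_free_from_def cube_free_Cons_Cons_neq)
  next
    assume "w \<in> (\<lambda>w. c # c # w) ` cube_free_from (\<not> c) m"
    then obtain v where v: "w = c # c # v" "v \<in> cube_free_from (\<not> c) m" by blast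
    then show ?thesis by (simp add: cube_free_from_def cube_free_Cons_Cons_same)
  qed
qed

lemma finite_cube_free_from: "finite (cube_free_from c m)"
  by (rule finite_subset[OF _ finite_lists_length_eq[of UNIV m]]) (auto simp: cube_free_from_def)

lemma card_cube_free_from: "card (cube_free_from c m) = fib (Suc m)"
proof (induction m arbitrary: c rule: fib.induct)
  case (3 m)
  \<comment> \<open>The second letter distinguishes the two parts.\<close>
  have "((#) c ` cube_free_from (\<not> c) (Suc m)) \<inter> ((\<lambda>w. c # c # w) ` cube_free_from (\<not> c) m) = {}"
    by (auto simp: cube_free_from_def)
  then have "card (cube_free_from c (Suc (Suc m))) =
      card (cube_free_from (\<not> c) (Suc m)) + card (cube_free_from (\<not> c) m)"
    by (simp add: cube_free_from_Suc_Suc card_Un_disjoint finite_cube_free_from card_image inj_on_def)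
  then show ?case using 3 by simp
qed (simp_all add: cube_free_from_0 cube_free_from_1)

text \<open>Source of the \<open>- 1\<close> in the growth formula; \<open>Suc\<close> avoids
  subtraction of naturals.\<close>

lemma sum_fib: "Suc (\<Sum>m\<le>k. fib (Suc m)) = fib (k + 3)"
  by (induction k) (simp_all add: numeral_eq_Suc)

section \<open>Normal forms in \<open>\<int>/3 * \<int>/3\<close>\<close>

definition gen :: "bool \<Rightarrow> (int + int) list set"
  where "gen c = (if c then gen_a else gen_b)"

definition word_val :: "bool list \<Rightarrow> (int + int) list set"
  where "word_val w = foldr (\<lambda>c z. gen c \<otimes>\<^bsub>Z3Z3\<^esub> z) w \<one>\<^bsub>Z3Z3\<^esub>"

lemma word_val_simps [simp]:
  "word_val [] = \<one>\<^bsub>Z3Z3\<^esub>" "word_val (c # w) = gen c \<otimes>\<^bsub>Z3Z3\<^esub> word_val w"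
  by (simp_all add: word_val_def)

lemma gen_carrier [simp]: "gen c \<in> carrier Z3Z3"
  by (simp add: gen_def gen_closed)

lemma gen_gen_gen:
  assumes "z \<in> carrier Z3Z3"
  shows "gen c \<otimes>\<^bsub>Z3Z3\<^esub> (gen c \<otimes>\<^bsub>Z3Z3\<^esub> (gen c \<otimes>\<^bsub>Z3Z3\<^esub> z)) = z"
proof -
  interpret group Z3Z3 by (rule group_Z3Z3)
  have "gen c [^]\<^bsub>Z3Z3\<^esub> (3::nat) = \<one>\<^bsub>Z3Z3\<^esub>" by (simp add: gen_def gen_cubes)
  then have "gen c \<otimes>\<^bsub>Z3Z3\<^esub> gen c \<otimes>\<^bsub>Z3Z3\<^esub> gen c = \<one>\<^bsub>Z3Z3\<^esub>"
    by (simp add: numeral_3_eq_3)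
  then show ?thesis using assms by (simp flip: m_assoc)
qed

lemma word_val_carrier [simp]: "word_val w \<in> carrier Z3Z3"
proof -
  interpret group Z3Z3 by (rule group_Z3Z3)
  show ?thesis by (induction w) auto
qed

lemma word_val_push: "word_val (push c w) = gen c \<otimes>\<^bsub>Z3Z3\<^esub> word_val w"
  by (cases "(c, w)" rule: push.cases) (auto simp: gen_gen_gen)

lemma word_val_foldr_push: "word_val (foldr push w []) = word_val w"
  by (induction w) (auto simp: word_val_push)

text \<open>Provides the hypotheses of \<open>Z3Z3_universal\<close> for the two pushes. They are
  restricted because the elements of \<open>BijGroup\<close> are extensional.\<close>

lemma restrict_push_BijGroup:
  defines "B \<equiv> BijGroup {w. cube_free w}"
  shows "restrict (push c) {w. cube_free w} \<in> carrier B"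
    and "restrict (push c) {w. cube_free w} [^]\<^bsub>B\<^esub> (3::nat) = \<one>\<^bsub>B\<^esub>"
proof -
  let ?C = "{w. cube_free w}" and ?p = "restrict (push c) {w. cube_free w}"
  \<comment> \<open>The inverse of \<open>push c\<close> is its square.\<close>
  have "bij_betw (push c) ?C ?C"
    by (rule bij_betw_byWitness[of _ "\<lambda>w. push c (push c w)"])
      (auto simp: push_push_push cube_free_push)
  then have p: "?p \<in> Bij ?C"
    using bij_betw_cong[of ?C ?p "push c" ?C] by (simp add: Bij_def)
  then show c: "?p \<in> carrier B"
    by (simp add: B_def BijGroup_def)
  interpret B: group B unfolding B_def by (rule group_BijGroup)
  have cl: "?p \<otimes>\<^bsub>B\<^esub> ?p \<in> Bij ?C"
    using B.m_closed[OF c c] by (simp add: B_def BijGroup_def)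
  have "?p [^]\<^bsub>B\<^esub> (3::nat) = ?p \<otimes>\<^bsub>B\<^esub> ?p \<otimes>\<^bsub>B\<^esub> ?p"
    using c by (simp add: numeral_3_eq_3)
  also have "\<dots> = compose ?C (compose ?C ?p ?p) ?p"
    using p cl by (simp add: B_def BijGroup_def)
  also have "\<dots> = (\<lambda>w\<in>?C. w)"
    by (auto simp: compose_def cube_free_push push_push_push fun_eq_iff)
  finally show "?p [^]\<^bsub>B\<^esub> (3::nat) = \<one>\<^bsub>B\<^esub>"
    by (simp add: B_def BijGroup_def)
qed

text \<open>Van der Waerden's argument: the group acts on cube-free words, each generator by its
  push. The value of a word \<open>w\<close> sends the empty word to \<open>foldr push w []\<close>,
  which is \<open>w\<close> itself when \<open>w\<close> is cube-free, so the value determines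
  \<open>w\<close>.\<close>

lemma inj_on_word_val: "inj_on word_val {w. cube_free w}"
proof -
  let ?C = "{w. cube_free w}" let ?B = "BijGroup {w. cube_free w}"
  obtain h where h: "h \<in> hom Z3Z3 ?B"
    "h gen_a = restrict (push True) ?C" "h gen_b = restrict (push False) ?C"
    using Z3Z3_universal[OF group_BijGroup restrict_push_BijGroup restrict_push_BijGroup]
    by blast
  have hg: "h (gen c) = restrict (push c) ?C" for c
    using h by (cases c) (simp_all add: gen_def)
  have hB: "h z \<in> Bij ?C" if "z \<in> carrier Z3Z3" for z
    using hom_in_carrier[OF h(1) that] by (simp add: BijGroup_def)
  interpret h: group_hom Z3Z3 ?B h
    using h(1) by (simp add: group_hom_def group_hom_axioms_def group_BijGroup group_Z3Z3)
  have "h (word_val w) [] = foldr push w []" for w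
  proof (induction w)
    case Nil
    then show ?case by (simp add: BijGroup_def)
  next
    case (Cons c w)
    have "h (word_val (c # w)) = compose ?C (h (gen c)) (h (word_val w))"
      using hB[of "gen c"] hB[of "word_val w"] by (simp add: BijGroup_def)
    then show ?case using Cons
      by (simp add: compose_def hg cube_free_foldr_push)
  qed
  then show ?thesis
    by (metis (mono_tags, lifting) foldr_push_cube_free inj_onI mem_Collect_eq)
qed

section \<open>The orbits of the interchange of letters\<close>

context
  fixes \<phi> :: "(int + int) list set \<Rightarrow> (int + int) list set"
  assumes \<phi>: "\<phi> \<in> carrier (AutoGroup Z3Z3)" and ab: "\<phi> gen_a = gen_b" "\<phi> gen_b = gen_a"
begin

lemma swap_gen: "\<phi> (gen c) = gen (\<not> c)"
  using ab by (simp add: gen_def)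

lemma swap_word_val: "\<phi> (word_val w) = word_val (map Not w)"
proof -
  have "\<phi> \<in> hom Z3Z3 Z3Z3" using \<phi> by (simp add: AutoGroup_def auto_def)
  then interpret group_hom Z3Z3 Z3Z3 \<phi>
    by (simp add: group_hom_def group_hom_axioms_def group_Z3Z3)
  show ?thesis by (induction w) (auto simp: swap_gen)
qed

lemma coset_proj_word_val:
  "coset_proj Z3Z3 \<phi> (word_val w) = {word_val w, word_val (map Not w)}"
proof -
  have "{0..<2::nat} = {0, 1}" by auto
  then show ?thesis
    using coset_proj_eq[OF group_Z3Z3 \<phi>, of "word_val w"] swap_ord[OF \<phi> ab]
    by (simp add: swap_word_val)
qed

lemma coset_proj_map_Not:
  "coset_proj Z3Z3 \<phi> (word_val (map Not w)) = coset_proj Z3Z3 \<phi> (word_val w)"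
  by (auto simp: coset_proj_word_val comp_def)

text \<open>Orbits have the form \<open>{word_val w, word_val (map Not w)}\<close>, and the
  interchange preserves cube-freeness, so uniqueness of normal forms applies.\<close>

lemma coset_proj_word_val_eq_iff:
  assumes "cube_free v" "cube_free w"
  shows "coset_proj Z3Z3 \<phi> (word_val v) = coset_proj Z3Z3 \<phi> (word_val w) \<longleftrightarrow> v = w \<or> v = map Not w"
proof
  assume "coset_proj Z3Z3 \<phi> (word_val v) = coset_proj Z3Z3 \<phi> (word_val w)"
  then have "word_val v = word_val w \<or> word_val v = word_val (map Not w)"
    by (auto simp: coset_proj_word_val)
  then show "v = w \<or> v = map Not w"
    using assms inj_onD[OF inj_on_word_val] by (auto simp: cube_free_map_Not)
qed (auto simp: coset_proj_map_Not)

section \<open>Products with \<open>g\<close> and powers of \<open>g\<close>\<close>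

lemma set_mset_coset_mult_gen:
  "set_mset (coset_mult Z3Z3 \<phi> (coset_proj Z3Z3 \<phi> gen_a) (coset_proj Z3Z3 \<phi> (word_val w))) =
    (\<lambda>c. coset_proj Z3Z3 \<phi> (word_val (c # w))) ` UNIV"
proof -
  have n: "0 < group.ord (AutoGroup Z3Z3) \<phi>" using swap_ord[OF \<phi> ab] by simp
  have sp: "coset_proj Z3Z3 \<phi> z \<in> coset_space Z3Z3 \<phi>" if "z \<in> carrier Z3Z3" for z
    using that by (simp add: coset_space_eq[OF group_Z3Z3 \<phi> n])
  have e: "{0..<2::nat} = {0, 1}" by auto
  \<comment> \<open>The representatives picked by \<open>SOME\<close> are replaced by
    \<open>gen True\<close> and \<open>word_val w\<close>.\<close>
  have "set_mset (coset_mult Z3Z3 \<phi> (coset_proj Z3Z3 \<phi> gen_a) (coset_proj Z3Z3 \<phi> (word_val w))) =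
      {coset_proj Z3Z3 \<phi> (gen True \<otimes>\<^bsub>Z3Z3\<^esub> word_val w),
       coset_proj Z3Z3 \<phi> (gen True \<otimes>\<^bsub>Z3Z3\<^esub> word_val (map Not w))}"
    by (subst coset_mult_eq[OF group_Z3Z3 \<phi> n sp _ sp, of _ "gen True" _ "word_val w"])
      (auto simp: gen_closed coset_proj_gen_a[OF \<phi> ab] coset_proj_word_val gen_def
        swap_ord[OF \<phi> ab] e swap_word_val)
  \<comment> \<open>\<open>True # map Not w\<close> is the interchange of \<open>False # w\<close>,
    so both have the same orbit.\<close>
  also have "\<dots> = {coset_proj Z3Z3 \<phi> (word_val (True # w)), coset_proj Z3Z3 \<phi> (word_val (False # w))}"
    using coset_proj_map_Not[of "False # w"] by simp
  also have "\<dots> = (\<lambda>c. coset_proj Z3Z3 \<phi> (word_val (c # w))) ` UNIV"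
    by (auto simp: UNIV_bool)
  finally show ?thesis .
qed

text \<open>Each multiplication by \<open>g\<close> prepends either letter. For \<open>k = 0\<close>
  the default value, the unit, is the orbit of the empty word.\<close>

lemma set_mset_coset_pow:
  "set_mset (coset_pow Z3Z3 \<phi> (coset_proj Z3Z3 \<phi> gen_a) k) =
    (\<lambda>w. coset_proj Z3Z3 \<phi> (word_val w)) ` {w. length w = k}"
proof (cases k)
  case 0
  then show ?thesis by (simp add: coset_unit_def)
next
  interpret group Z3Z3 by (rule group_Z3Z3)
  case (Suc m)
  have "set_mset (coset_pow Z3Z3 \<phi> (coset_proj Z3Z3 \<phi> gen_a) (Suc m)) =
    (\<lambda>w. coset_proj Z3Z3 \<phi> (word_val w)) ` {w. length w = Suc m}"
  proof (induction m)
    case 0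
    \<comment> \<open>Written with \<open>map Not\<close> to show that the two one-letter words
      share the orbit \<open>g\<close>.\<close>
    have "{w :: bool list. length w = Suc 0} = {[True], map Not [True]}"
      by (auto simp: length_Suc_conv)
    moreover have "coset_proj Z3Z3 \<phi> gen_a = coset_proj Z3Z3 \<phi> (word_val [True])"
      by (simp add: gen_def gen_closed)
    ultimately show ?case
      by (simp only: image_insert coset_proj_map_Not) simp
  next
    case (Suc m)
    have "{w :: bool list. length w = Suc (Suc m)} = (\<Union>w\<in>{w. length w = Suc m}. range (\<lambda>c. c # w))"
      by (auto simp: length_Suc_conv)
    then show ?case
      using Suc by (simp add: set_mset_coset_mult_gen image_UN image_image)
  qed
  then show ?thesis using Suc by simp
qed

lemma coset_growth_eq:
  "coset_growth Z3Z3 \<phi> (coset_proj Z3Z3 \<phi> gen_a) k = (\<Sum>m\<le>k. fib (Suc m))"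
proof -
  let ?p = "\<lambda>w. coset_proj Z3Z3 \<phi> (word_val w)"
  let ?R = "\<Union>m\<le>k. cube_free_from True m"
  have "{coset_unit Z3Z3 \<phi>} \<union>
      (\<Union>i\<in>{1..k}. set_mset (coset_pow Z3Z3 \<phi> (coset_proj Z3Z3 \<phi> gen_a) i)) =
      (\<Union>i\<le>k. set_mset (coset_pow Z3Z3 \<phi> (coset_proj Z3Z3 \<phi> gen_a) i))"
  proof -
    \<comment> \<open>The separately added unit is the term of index 0.\<close>
    have "{..k} = insert 0 {1..k}" by auto
    then show ?thesis by simp
  qed
  also have "\<dots> = ?p ` {w. length w \<le> k}"
    by (auto simp: set_mset_coset_pow)
  also have "\<dots> = ?p ` ?R"
  proof (intro subset_antisym subsetI)
    fix x assume "x \<in> ?p ` {w. length w \<le> k}"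
    then obtain w where w: "length w \<le> k" "x = ?p w" by auto
    define v where "v = foldr push w []"
    have v: "cube_free v" "length v \<le> k" "x = ?p v"
      using w length_foldr_push[of w]
      by (auto simp: v_def cube_free_foldr_push word_val_foldr_push)
    \<comment> \<open>If the normal form \<open>v\<close> starts with \<open>b\<close>, its
      interchange starts with \<open>a\<close>.\<close>
    have "v \<in> ?R \<or> map Not v \<in> ?R"
      using v(1,2) cube_free_map_Not[of v] by (cases v) (auto simp: cube_free_from_def)
    then show "x \<in> ?p ` ?R"
      using v(3) coset_proj_map_Not[of v] by (metis imageI)
  qed (auto simp: cube_free_from_def)
  finally have "coset_growth Z3Z3 \<phi> (coset_proj Z3Z3 \<phi> gen_a) k = card (?p ` ?R)"
    by (simp add: coset_growth_def)
  also have "\<dots> = card ?R"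
  proof (rule card_image, rule inj_onI)
    fix v w assume vw: "v \<in> ?R" "w \<in> ?R" "?p v = ?p w"
    then have "v = w \<or> v = map Not w"
      by (subst coset_proj_word_val_eq_iff[symmetric]) (auto simp: cube_free_from_def)
    \<comment> \<open>Both words are empty or start with \<open>a\<close>, so
      \<open>v = map Not w\<close> is possible only for empty words.\<close>
    then show "v = w"
      using vw by (cases w) (auto simp: cube_free_from_def)
  qed
  \<comment> \<open>The sets are disjoint because the lengths differ.\<close>
  also have "\<dots> = (\<Sum>m\<le>k. card (cube_free_from True m))"
    by (rule card_UN_disjoint) (simp_all add: finite_cube_free_from, auto simp: cube_free_from_def)
  finally show ?thesis by (simp add: card_cube_free_from)
qed

end

section \<open>Asymptotics\<close>

text \<open>The Fibonacci ratio tends to 1, and the subtracted 1 contributes \<open>sqrt 5\<close>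
  over a power of the golden ratio, which tends to 0.\<close>

lemma fib_minus_1_asymp_equiv:
  "(\<lambda>k. real (fib (k + 3)) - 1) \<sim>[at_top] (\<lambda>k. ((1 + sqrt 5) / 2) ^ (k + 3) / sqrt 5)"
proof (rule asymp_equivI')
  let ?x = "(1 + sqrt 5) / 2 :: real"
  have x: "1 < ?x"
    by (simp add: real_less_rsqrt)
  have "(\<lambda>k. real (fib (k + 3)) / (?x ^ (k + 3) / sqrt 5) - sqrt 5 * inverse (?x ^ (k + 3))) \<longlonglongrightarrow> 1 - sqrt 5 * 0"
  proof (intro tendsto_diff tendsto_mult tendsto_const)
    show "(\<lambda>k. real (fib (k + 3)) / (?x ^ (k + 3) / sqrt 5)) \<longlonglongrightarrow> 1"
      using fib_asymptotics by (rule LIMSEQ_ignore_initial_segment)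
    show "(\<lambda>k. inverse (?x ^ (k + 3))) \<longlonglongrightarrow> 0"
      using LIMSEQ_inverse_realpow_zero[OF x] by (rule LIMSEQ_ignore_initial_segment)
  qed
  moreover have "(real (fib (k + 3)) - 1) / (?x ^ (k + 3) / sqrt 5) =
      real (fib (k + 3)) / (?x ^ (k + 3) / sqrt 5) - sqrt 5 * inverse (?x ^ (k + 3))" for k
    by (simp only: diff_divide_distrib divide_divide_eq_right[of 1] mult_1_left divide_inverse[of "sqrt 5"])
  ultimately show "(\<lambda>k. (real (fib (k + 3)) - 1) / (?x ^ (k + 3) / sqrt 5)) \<longlonglongrightarrow> 1"
    by (simp only: mult_zero_right diff_zero)
qed

theorem proposition1:
  fixes \<phi> :: "(int + int) list set \<Rightarrow> (int + int) list set"
  assumes "\<phi> \<in> carrier (AutoGroup Z3Z3)"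
    and "group.ord (AutoGroup Z3Z3) \<phi> = 2"
    and "\<phi> gen_a = gen_b" and "\<phi> gen_b = gen_a"
  shows "let g = coset_proj Z3Z3 \<phi> gen_a;
             \<xi> = coset_growth Z3Z3 \<phi> g
         in (\<forall>k::nat. real (\<xi> k) = real (fib (k + 3)) - 1 \<and>
               real (fib (k + 3)) - 1 =
                 1 / sqrt 5 * (((1 + sqrt 5) / 2) ^ (k + 3) - ((1 - sqrt 5) / 2) ^ (k + 3)) - 1) \<and>
            (\<lambda>k::nat. real (\<xi> k)) \<sim>[at_top] (\<lambda>k. ((1 + sqrt 5) / 2) ^ (k + 3) / sqrt 5)"
proof -
  have growth: "real (coset_growth Z3Z3 \<phi> (coset_proj Z3Z3 \<phi> gen_a) k) = real (fib (k + 3)) - 1" for k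
    using coset_growth_eq[OF assms(1,3,4), of k] sum_fib[of k] by linarith
  show ?thesis
    \<comment> \<open>The middle equation is Binet's formula,
      \<open>fib_closed_form\<close>.\<close>
    unfolding Let_def growth using fib_minus_1_asymp_equiv
    by (simp add: fib_closed_form)
qed

end
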